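(* For positive integers $k\ge \ell$, the limits \[a_{k,\ell}=\lim_{n\to\infty}\frac{a_{n,k,\ell}}{n^{k-1}},\qquad b_{k,\ell}=\lim_{n\to\infty}\frac{b_{n,k,\ell}}{n^{k-1}}\] exist.
   Context: Let $H_{n,k}=\{0,1,\dots,n-1\}^k$. For $\ell\le k$, an $\ell$-rook is a point $P\in H_{n,k}$ together with a set $D$ of $\ell$ of the $k$ coordinate indices; it covers (attacks) $P$ itself and every point of $H_{n,k}$ which differs from $P$ in exactly one coordinate, that coordinate belonging to $D$. Distinct rooks must occupy distinct points. $a_{n,k,\ell}$ is the minimum number of $\ell$-rooks whose covered sets together cover $H_{n,k}$; $b_{n,k,\ell}$ is the maximum number of $\ell$-rooks that can be placed in $H_{n,k}$ so that no rook attacks the position of another rook. *)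

theory Defs
  imports Complex_Main "HOL-Library.FuncSet"
begin

text \<open>Coordinates are indexed by \<open>{..<k}\<close>; points are extensional functions
  (\<open>undefined\<close> outside \<open>{..<k}\<close>), so equality of functions is equality of points.\<close>

definition grid :: "nat \<Rightarrow> nat \<Rightarrow> (nat \<Rightarrow> nat) set" where
  "grid n k = ({..<k} \<rightarrow>\<^sub>E {..<n})"

type_synonym rook = "(nat \<Rightarrow> nat) \<times> nat set"

definition rooks :: "nat \<Rightarrow> nat \<Rightarrow> nat \<Rightarrow> rook set" where
  "rooks n k l = {(P, D). P \<in> grid n k \<and> D \<subseteq> {..<k} \<and> card D = l}"

definition covered :: "nat \<Rightarrow> nat \<Rightarrow> rook \<Rightarrow> (nat \<Rightarrow> nat) set" where
  "covered n k = (\<lambda>(P, D). {Q \<in> grid n k.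
     Q = P \<or> (\<exists>i\<in>D. Q i \<noteq> P i \<and> (\<forall>j\<in>{..<k} - {i}. Q j = P j))})"

text \<open>Injectivity of \<open>fst\<close> says that distinct rooks occupy distinct points.\<close>

definition placements :: "nat \<Rightarrow> nat \<Rightarrow> nat \<Rightarrow> rook set set" where
  "placements n k l = {R. R \<subseteq> rooks n k l \<and> inj_on fst R}"

definition covering_placements :: "nat \<Rightarrow> nat \<Rightarrow> nat \<Rightarrow> rook set set" where
  "covering_placements n k l =
     {R \<in> placements n k l. (\<Union>r\<in>R. covered n k r) = grid n k}"

definition nonattacking_placements :: "nat \<Rightarrow> nat \<Rightarrow> nat \<Rightarrow> rook set set" where
  "nonattacking_placements n k l =
     {R \<in> placements n k l. \<forall>r\<in>R. \<forall>s\<in>R. r \<noteq> s \<longrightarrow> fst s \<notin> covered n k r}"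

definition min_covering :: "nat \<Rightarrow> nat \<Rightarrow> nat \<Rightarrow> nat" where
  "min_covering n k l = Min (card ` covering_placements n k l)"

definition max_nonattacking :: "nat \<Rightarrow> nat \<Rightarrow> nat \<Rightarrow> nat" where
  "max_nonattacking n k l = Max (card ` nonattacking_placements n k l)"

text \<open>The minimum and the maximum above range over finite nonempty sets of finite sets.\<close>

lemma finite_rooks: "finite (rooks n k l)"
proof -
  have "rooks n k l \<subseteq> grid n k \<times> Pow {..<k}"
    by (auto simp: rooks_def)
  moreover have "finite (grid n k \<times> Pow {..<k})"
    by (auto simp: grid_def intro!: finite_PiE)
  ultimately show ?thesis
    by (rule finite_subset)
qed

lemma finite_placements: "finite (placements n k l)"
  by (rule finite_subset[of _ "Pow (rooks n k l)"]) (auto simp: placements_def finite_rooks)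

lemma finite_placement: "R \<in> placements n k l \<Longrightarrow> finite R"
  by (auto simp: placements_def intro: finite_subset[OF _ finite_rooks])

lemma finite_covering_placements: "finite (covering_placements n k l)"
  by (rule finite_subset[OF _ finite_placements]) (auto simp: covering_placements_def)

lemma finite_nonattacking_placements: "finite (nonattacking_placements n k l)"
  by (rule finite_subset[OF _ finite_placements]) (auto simp: nonattacking_placements_def)

lemma covering_placements_nonempty:
  assumes "l \<le> k"
  shows "covering_placements n k l \<noteq> {}"
proof -
  have "(\<lambda>P. (P, {..<l})) ` grid n k \<in> covering_placements n k l"
    using assms
    by (auto simp: covering_placements_def placements_def rooks_def covered_def inj_on_def)
  then show ?thesis by blast
qed

lemma nonattacking_placements_nonempty: "nonattacking_placements n k l \<noteq> {}"
proof -
  have "{} \<in> nonattacking_placements n k l"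
    by (simp add: nonattacking_placements_def placements_def)
  then show ?thesis by blast
qed

end

theory Submission
  imports Defs "HOL-Number_Theory.Cong"
begin

text \<open>The points of a grid of side \<open>m * n\<close> whose coordinate sum is divisible by \<open>m\<close> meet every line
  of every \<open>m \<times> \<dots> \<times> m\<close> block exactly once. Replacing each rook of a placement on the grid of
  side \<open>n\<close> by rooks on these points of the corresponding block multiplies the number of rooks by
  \<open>m ^ (k - 1)\<close> and preserves both the covering and the nonattacking property. So both normalised
  sequences are monotone along multiples, in opposite directions. Enlarging the side from \<open>N\<close> to \<open>M\<close>
  costs at most \<open>k * (M - N) * M ^ (k - 2)\<close> further rooks for coverings and loses none for nonattacking
  placements, so a Fekete-type argument shows that the limits are the infimum and the supremum.\<close>

section \<open>Extremal placements and elementary facts on grids\<close>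

lemma min_covering_le: "R \<in> covering_placements n k l \<Longrightarrow> min_covering n k l \<le> card R"
  unfolding min_covering_def by (simp add: finite_covering_placements)

lemma min_covering_attained:
  assumes "l \<le> k"
  obtains R where "R \<in> covering_placements n k l" "card R = min_covering n k l"
proof -
  have "min_covering n k l \<in> card ` covering_placements n k l"
    unfolding min_covering_def using finite_covering_placements covering_placements_nonempty[OF assms]
    by (intro Min_in) auto
  then show thesis using that by auto
qed

lemma max_nonattacking_ge: "R \<in> nonattacking_placements n k l \<Longrightarrow> card R \<le> max_nonattacking n k l"
  unfolding max_nonattacking_def by (simp add: finite_nonattacking_placements)

lemma max_nonattacking_attained:
  obtains R where "R \<in> nonattacking_placements n k l" "card R = max_nonattacking n k l"
proof -
  have "max_nonattacking n k l \<in> card ` nonattacking_placements n k l"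
    unfolding max_nonattacking_def using finite_nonattacking_placements nonattacking_placements_nonempty
    by (intro Max_in) auto
  then show thesis using that by auto
qed

lemma finite_grid: "finite (grid n k)"
  by (auto simp: grid_def intro!: finite_PiE)

lemma card_grid: "card (grid n k) = n ^ k"
  by (simp add: grid_def card_PiE)

lemma grid_less: "P \<in> grid n k \<Longrightarrow> i < k \<Longrightarrow> P i < n"
  by (auto simp: grid_def)

lemma grid_update: "P \<in> grid n k \<Longrightarrow> i < k \<Longrightarrow> v < n \<Longrightarrow> P(i := v) \<in> grid n k"
  by (auto simp: grid_def PiE_def extensional_def)

lemma grid_eqI: "P \<in> grid n k \<Longrightarrow> Q \<in> grid n' k \<Longrightarrow> (\<And>i. i < k \<Longrightarrow> P i = Q i) \<Longrightarrow> P = Q"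
  by (auto simp: grid_def PiE_def intro: extensionalityI)

lemma grid_mono: "n \<le> m \<Longrightarrow> grid n k \<subseteq> grid m k"
  by (auto simp: grid_def PiE_def Pi_def)

lemma mem_rooks_iff:
  "r \<in> rooks n k l \<longleftrightarrow> fst r \<in> grid n k \<and> snd r \<subseteq> {..<k} \<and> card (snd r) = l"
  by (cases r) (simp add: rooks_def)

lemma mem_covered_iff:
  "Q \<in> covered n k r \<longleftrightarrow> Q \<in> grid n k \<and>
    (Q = fst r \<or> (\<exists>i\<in>snd r. Q i \<noteq> fst r i \<and> (\<forall>j\<in>{..<k} - {i}. Q j = fst r j)))"
  by (cases r) (simp add: covered_def)

section \<open>Coordinate sums modulo \<open>m\<close>\<close>

lemma ex_dvd_add:
  fixes m s :: nat
  assumes "0 < m" shows "\<exists>v<m. m dvd s + v"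
proof -
  \<comment> \<open>The outer \<open>mod m\<close> handles the case \<open>s mod m = 0\<close>,
    where the difference would be \<open>m\<close> instead of \<open>0\<close>.\<close>
  define v where "v = (m - s mod m) mod m"
  have "(s + v) mod m = (s mod m + (m - s mod m)) mod m"
    unfolding v_def by presburger
  also have "\<dots> = 0" using assms by (simp add: less_imp_le)
  finally show ?thesis using assms by (intro exI[of _ v]) (auto simp: v_def)
qed

text \<open>Modulo \<open>m\<close> the new entry contributes only \<open>v\<close>, which can
  cancel the other coordinates. This is the existence half: every line of a block contains a point
  with divisible coordinate sum.\<close>

lemma ex_update_dvd_sum:
  fixes Q :: "nat \<Rightarrow> nat"
  assumes "0 < m" "i < k"
  shows "\<exists>v<m. m dvd (\<Sum>j<k. (Q(i := m * c + v)) j)"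
proof -
  obtain v where v: "v < m" "m dvd (\<Sum>j\<in>{..<k} - {i}. Q j) + v"
    using ex_dvd_add[OF assms(1)] by blast
  have "(\<Sum>j<k. (Q(i := m * c + v)) j) = m * c + (v + (\<Sum>j\<in>{..<k} - {i}. Q j))"
    using assms(2) by (subst sum.remove[of _ i]) auto
  then show ?thesis using v by (auto simp: add.commute)
qed

text \<open>Once all other residues are fixed, the sum being 0 modulo \<open>m\<close> determines
  the last one. This is the uniqueness half: a line of a block contains at most one such
  point.\<close>

lemma dvd_sum_imp_mod_eq:
  fixes Z Z' :: "nat \<Rightarrow> nat"
  assumes "i < k" "m dvd (\<Sum>j<k. Z j)" "m dvd (\<Sum>j<k. Z' j)"
    and "\<And>j. j < k \<Longrightarrow> j \<noteq> i \<Longrightarrow> Z j mod m = Z' j mod m"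
  shows "Z i mod m = Z' i mod m"
proof -
  have rest: "[(\<Sum>j\<in>{..<k} - {i}. Z j) = (\<Sum>j\<in>{..<k} - {i}. Z' j)] (mod m)"
    using assms(4) by (intro cong_sum) (auto simp: cong_def)
  have "[(\<Sum>j<k. Z j) = (\<Sum>j<k. Z' j)] (mod m)"
    using assms(2,3) by (simp add: cong_def mod_eq_0_iff_dvd)
  then have "[Z i + (\<Sum>j\<in>{..<k} - {i}. Z j) = Z' i + (\<Sum>j\<in>{..<k} - {i}. Z' j)] (mod m)"
    using assms(1) by (simp add: sum.remove[of _ i])
  moreover have "[Z' i + (\<Sum>j\<in>{..<k} - {i}. Z' j) = Z' i + (\<Sum>j\<in>{..<k} - {i}. Z j)] (mod m)"
    using rest by (simp add: cong_sym cong_add)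
  ultimately have "[Z i + (\<Sum>j\<in>{..<k} - {i}. Z j) = Z' i + (\<Sum>j\<in>{..<k} - {i}. Z j)] (mod m)"
    by (rule cong_trans)
  then show ?thesis by (simp add: cong_add_rcancel_nat cong_def[symmetric])
qed

section \<open>Blowing up a placement by the factor \<open>m\<close>\<close>

definition block :: "nat \<Rightarrow> nat \<Rightarrow> (nat \<Rightarrow> nat) \<Rightarrow> nat \<Rightarrow> nat" where
  "block k m Z = (\<lambda>i\<in>{..<k}. Z i div m)"

text \<open>For positive \<open>m\<close> and \<open>k\<close>, the points chosen inside one block
  form a Latin hypercube; all of them inherit the direction set of the rook they replace.\<close>

definition blowup :: "nat \<Rightarrow> nat \<Rightarrow> nat \<Rightarrow> rook set \<Rightarrow> rook set" where
  "blowup n k m R =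
     {(Z, D). Z \<in> grid (m * n) k \<and> m dvd (\<Sum>i<k. Z i) \<and> (block k m Z, D) \<in> R}"

lemma block_in_grid: "Z \<in> grid (m * n) k \<Longrightarrow> block k m Z \<in> grid n k"
  by (auto simp: grid_def block_def less_mult_imp_div_less mult.commute dest!: PiE_mem)

lemma block_eqI: "P \<in> grid n k \<Longrightarrow> (\<And>i. i < k \<Longrightarrow> Z i div m = P i) \<Longrightarrow> block k m Z = P"
  by (auto simp: grid_def PiE_def extensional_def block_def fun_eq_iff)

lemma mult_add_less_mult:
  fixes m n a v :: nat
  assumes "a < n" "v < m" shows "m * a + v < m * n"
proof -
  have "m * a + v < m * Suc a" using assms(2) by simp
  also have "\<dots> \<le> m * n" using assms(1) by (intro mult_le_mono2) simp
  finally show ?thesis .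
qed

lemma placement_dirs_unique:
  "R \<in> placements n k l \<Longrightarrow> (P, D) \<in> R \<Longrightarrow> (P, D') \<in> R \<Longrightarrow> D = D'"
  using inj_onD[of fst R "(P, D)" "(P, D')"] by (simp add: placements_def)

lemma blowup_placement:
  assumes "R \<in> placements n k l" shows "blowup n k m R \<in> placements (m * n) k l"
proof -
  have "inj_on fst (blowup n k m R)"
    by (auto simp: blowup_def inj_on_def dest: placement_dirs_unique[OF assms])
  then show ?thesis using assms by (auto simp: placements_def blowup_def rooks_def)
qed

text \<open>The first \<open>k - 1\<close> residues inside a block are arbitrary and the last one is
  then forced, so the blow-up is in bijection with \<open>R \<times> grid m (k - 1)\<close>.\<close>

lemma card_blowup:
  assumes R: "R \<in> placements n k l" and "0 < m" "0 < k"
  shows "card (blowup n k m R) = m ^ (k - 1) * card R"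
proof -
  define g where "g = (\<lambda>(Z, D :: nat set). ((block k m Z, D), (\<lambda>i\<in>{..<k - 1}. Z i mod m)))"
  have mod_in_grid: "(\<lambda>i\<in>{..<k - 1}. Z i mod m) \<in> grid m (k - 1)" for Z
    using \<open>0 < m\<close> by (simp add: grid_def)
  have "inj_on g (blowup n k m R)"
  proof (rule inj_onI, clarify)
    fix Z D Z' D' assume in_blowup: "(Z, D) \<in> blowup n k m R" "(Z', D') \<in> blowup n k m R"
      and eq: "g (Z, D) = g (Z', D')"
    have div_eq: "Z i div m = Z' i div m" if "i < k" for i
    proof -
      have "block k m Z i = block k m Z' i" using eq by (simp add: g_def)
      then show ?thesis using that by (simp add: block_def)
    qed
    have mod_eq: "Z i mod m = Z' i mod m" if "i < k - 1" for i
    proof -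
      have "(\<lambda>i\<in>{..<k - 1}. Z i mod m) i = (\<lambda>i\<in>{..<k - 1}. Z' i mod m) i"
        using eq by (simp add: g_def)
      then show ?thesis using that by simp
    qed
    have "Z (k - 1) mod m = Z' (k - 1) mod m"
      by (rule dvd_sum_imp_mod_eq[of _ k]) (use in_blowup \<open>0 < k\<close> mod_eq in \<open>auto simp: blowup_def\<close>)
    then have "Z i mod m = Z' i mod m" if "i < k" for i
      using mod_eq[of i] that by (cases "i = k - 1") auto
    then have "Z i = Z' i" if "i < k" for i
      using that div_eq div_mod_decomp[of "Z i" m] div_mod_decomp[of "Z' i" m] by presburger
    moreover have "Z \<in> grid (m * n) k" "Z' \<in> grid (m * n) k"
      using in_blowup by (auto simp: blowup_def)
    ultimately have "Z = Z'" by (blast intro: grid_eqI)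
    then show "Z = Z' \<and> D = D'" using eq by (simp add: g_def)
  qed
  moreover have "g ` blowup n k m R = R \<times> grid m (k - 1)"
  proof (intro equalityI subsetI)
    fix x assume "x \<in> g ` blowup n k m R"
    then show "x \<in> R \<times> grid m (k - 1)"
      using mod_in_grid by (auto simp: g_def blowup_def)
  next
    fix x assume "x \<in> R \<times> grid m (k - 1)"
    then obtain P D y where x: "x = ((P, D), y)" "(P, D) \<in> R" "y \<in> grid m (k - 1)" by auto
    have P: "P \<in> grid n k" using R x(2) by (auto simp: placements_def rooks_def)
    \<comment> \<open>As \<open>y\<close> is extensional on \<open>{..<k - 1}\<close>, the value
      \<open>W (k - 1)\<close> is unspecified; the update by \<open>v\<close> overwrites it.\<close>
    define W where "W = (\<lambda>i\<in>{..<k}. m * P i + y i)"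
    obtain v where v: "v < m" "m dvd (\<Sum>j<k. (W(k - 1 := m * P (k - 1) + v)) j)"
      using ex_update_dvd_sum[of m "k - 1" k W "P (k - 1)"] assms by auto
    define Z where "Z = W(k - 1 := m * P (k - 1) + v)"
    define r where "r = y(k - 1 := v)"
    have r: "r i < m" if "i < k" for i
      using that v(1) grid_less[OF x(3), of i] by (auto simp: r_def)
    have Z: "Z i = m * P i + r i" if "i < k" for i
      using that by (simp add: Z_def W_def r_def)
    have "Z i = undefined" if "\<not> i < k" for i using that \<open>0 < k\<close> by (auto simp: Z_def W_def)
    then have "Z \<in> grid (m * n) k"
      using Z r grid_less[OF P] mult_add_less_mult by (auto simp: grid_def PiE_def extensional_def)
    moreover have block: "block k m Z = P"
      using Z r \<open>0 < m\<close> by (intro block_eqI[OF P]) simp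
    ultimately have "(Z, D) \<in> blowup n k m R"
      using x(2) v(2) by (simp add: blowup_def Z_def)
    moreover have "(\<lambda>i\<in>{..<k - 1}. Z i mod m) = y"
    proof (rule grid_eqI[OF mod_in_grid x(3)])
      show "(\<lambda>i\<in>{..<k - 1}. Z i mod m) i = y i" if "i < k - 1" for i
        using that Z[of i] grid_less[OF x(3) that] by (simp add: r_def)
    qed
    then have "g (Z, D) = x" using block x(1) by (simp add: g_def)
    ultimately show "x \<in> g ` blowup n k m R" by force
  qed
  ultimately have "card (blowup n k m R) = card (R \<times> grid m (k - 1))"
    using card_image by metis
  then show ?thesis by (simp add: card_cartesian_product card_grid mult.commute)
qed

text \<open>If a rook at \<open>P\<close> covers the block of \<open>Q\<close> along axis
  \<open>i\<close>, then moving \<open>Q\<close> along that axis leads into the block of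
  \<open>P\<close>, and the offset there can be chosen so as to hit a rook of the blow-up.\<close>

lemma blowup_covering:
  assumes R: "R \<in> covering_placements n k l" and "0 < m" "1 \<le> l"
  shows "blowup n k m R \<in> covering_placements (m * n) k l"
proof -
  have placement: "R \<in> placements n k l" and cover: "(\<Union>r\<in>R. covered n k r) = grid n k"
    using R by (auto simp: covering_placements_def)
  have "\<exists>r\<in>blowup n k m R. Q \<in> covered (m * n) k r" if Q: "Q \<in> grid (m * n) k" for Q
  proof -
    have "block k m Q \<in> (\<Union>r\<in>R. covered n k r)" using block_in_grid[OF Q] cover by simp
    then obtain P D where PD: "(P, D) \<in> R" "block k m Q \<in> covered n k (P, D)" by auto
    have P: "P \<in> grid n k" "D \<subseteq> {..<k}" "card D = l"
      using placement PD(1) by (auto simp: placements_def rooks_def)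
    \<comment> \<open>If \<open>Q\<close> lies in the block of \<open>P\<close> itself, any
      direction in \<open>D\<close> can serve as \<open>i\<close>; one exists because
      \<open>1 \<le> l\<close>.\<close>
    have "D \<noteq> {}" using P(3) \<open>1 \<le> l\<close> by auto
    with PD(2) obtain i where i: "i \<in> D" "\<And>j. j < k \<Longrightarrow> j \<noteq> i \<Longrightarrow> block k m Q j = P j"
      by (auto simp: covered_def)
    have "i < k" using i(1) P(2) by auto
    obtain v where v: "v < m" "m dvd (\<Sum>j<k. (Q(i := m * P i + v)) j)"
      using ex_update_dvd_sum[OF \<open>0 < m\<close> \<open>i < k\<close>] by blast
    define Z where "Z = Q(i := m * P i + v)"
    have "Z \<in> grid (m * n) k"
      unfolding Z_def using grid_less[OF P(1) \<open>i < k\<close>] v(1)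
      by (intro grid_update[OF Q \<open>i < k\<close>] mult_add_less_mult)
    moreover have "block k m Z = P"
    proof (rule block_eqI[OF P(1)])
      show "Z j div m = P j" if "j < k" for j
        using that v(1) i(2)[of j] by (auto simp: Z_def block_def)
    qed
    ultimately have "(Z, D) \<in> blowup n k m R"
      using v(2) PD(1) by (simp add: blowup_def Z_def)
    moreover have "Q \<in> covered (m * n) k (Z, D)"
      using Q i(1) by (cases "Q i = Z i") (auto simp: covered_def Z_def)
    ultimately show ?thesis by blast
  qed
  moreover have "covered (m * n) k r \<subseteq> grid (m * n) k" for r by (auto simp: covered_def)
  ultimately show ?thesis
    using blowup_placement[OF placement] by (fastforce simp: covering_placements_def)
qed

text \<open>Two chosen points on a line along axis \<open>i\<close> agree modulo \<open>m\<close> at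
  \<open>i\<close>, so if distinct they lie in different blocks. These blocks differ only in
  coordinate \<open>i\<close>, which makes the original rooks attack as well.\<close>

lemma blowup_nonattacking:
  assumes R: "R \<in> nonattacking_placements n k l"
  shows "blowup n k m R \<in> nonattacking_placements (m * n) k l"
proof -
  have placement: "R \<in> placements n k l"
    and nonatt: "\<And>r s. r \<in> R \<Longrightarrow> s \<in> R \<Longrightarrow> r \<noteq> s \<Longrightarrow> fst s \<notin> covered n k r"
    using R by (auto simp: nonattacking_placements_def)
  have False if Z: "(Z, D) \<in> blowup n k m R" "(Z', D') \<in> blowup n k m R"
    and ne: "(Z, D) \<noteq> (Z', D')" and att: "Z' \<in> covered (m * n) k (Z, D)" for Z D Z' D'
  proof -
    have "Z' \<noteq> Z"
      using Z ne placement_dirs_unique[OF blowup_placement[OF placement]] by blast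
    then obtain i where i: "i \<in> D" "Z' i \<noteq> Z i" "\<And>j. j < k \<Longrightarrow> j \<noteq> i \<Longrightarrow> Z' j = Z j"
      using att by (auto simp: covered_def)
    have "i < k" using Z(1) i(1) placement by (auto simp: blowup_def placements_def rooks_def)
    then have "Z' i mod m = Z i mod m"
      by (rule dvd_sum_imp_mod_eq) (use Z i(3) in \<open>auto simp: blowup_def\<close>)
    with i(2) have "Z' i div m \<noteq> Z i div m" by (metis div_mod_decomp)
    then have block: "block k m Z' i \<noteq> block k m Z i" using \<open>i < k\<close> by (simp add: block_def)
    moreover have "block k m Z' j = block k m Z j" if "j < k" "j \<noteq> i" for j
      using that i(3) by (simp add: block_def)
    moreover have "block k m Z' \<in> grid n k" using Z(2) by (auto simp: blowup_def block_in_grid)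
    ultimately have "block k m Z' \<in> covered n k (block k m Z, D)"
      using i(1) by (auto simp: covered_def)
    moreover have "(block k m Z, D) \<in> R" "(block k m Z', D') \<in> R" using Z by (auto simp: blowup_def)
    ultimately show False using nonatt block by fastforce
  qed
  then show ?thesis
    using blowup_placement[OF placement] by (fastforce simp: nonattacking_placements_def)
qed

section \<open>Both numbers along multiples of the side\<close>

lemma min_covering_mult_le:
  assumes "1 \<le> l" "l \<le> k" "0 < m"
  shows "min_covering (m * n) k l \<le> m ^ (k - 1) * min_covering n k l"
proof -
  obtain R where R: "R \<in> covering_placements n k l" "card R = min_covering n k l"
    using min_covering_attained[OF assms(2)] .
  have "min_covering (m * n) k l \<le> card (blowup n k m R)"
    using blowup_covering[OF R(1)] assms by (intro min_covering_le) auto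
  also have "\<dots> = m ^ (k - 1) * min_covering n k l"
    using R assms by (subst card_blowup[of _ _ _ l]) (auto simp: covering_placements_def)
  finally show ?thesis .
qed

lemma max_nonattacking_mult_ge:
  assumes "0 < k" "0 < m"
  shows "m ^ (k - 1) * max_nonattacking n k l \<le> max_nonattacking (m * n) k l"
proof -
  obtain R where R: "R \<in> nonattacking_placements n k l" "card R = max_nonattacking n k l"
    using max_nonattacking_attained .
  have "m ^ (k - 1) * max_nonattacking n k l = card (blowup n k m R)"
    using R assms by (subst card_blowup[of _ _ _ l]) (auto simp: nonattacking_placements_def)
  also have "\<dots> \<le> max_nonattacking (m * n) k l"
    using blowup_nonattacking[OF R(1)] by (rule max_nonattacking_ge)
  finally show ?thesis .
qed

section \<open>Bounds, and the effect of enlarging the side\<close>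

text \<open>The same rooks are placed in the larger grid; whether one attacks the position of
  another does not depend on the side.\<close>

lemma max_nonattacking_mono:
  assumes "N \<le> M" shows "max_nonattacking N k l \<le> max_nonattacking M k l"
proof -
  obtain R where R: "R \<in> nonattacking_placements N k l" "card R = max_nonattacking N k l"
    using max_nonattacking_attained .
  have sub: "R \<subseteq> rooks N k l" "inj_on fst R"
    and nonatt: "\<And>r s. r \<in> R \<Longrightarrow> s \<in> R \<Longrightarrow> r \<noteq> s \<Longrightarrow> fst s \<notin> covered N k r"
    using R by (auto simp: nonattacking_placements_def placements_def)
  have "rooks N k l \<subseteq> rooks M k l" using grid_mono[OF assms] by (auto simp: rooks_def)
  moreover have "fst s \<notin> covered M k r" if "r \<in> R" "s \<in> R" "r \<noteq> s" for r s
    using nonatt[OF that] sub(1) that(2) by (auto simp: covered_def rooks_def)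
  ultimately have "R \<in> nonattacking_placements M k l"
    using sub by (auto simp: nonattacking_placements_def placements_def)
  then show ?thesis using max_nonattacking_ge R(2) by metis
qed

text \<open>The slice meets each line parallel to axis \<open>i\<close> once, so it serves to count
  these lines.\<close>

lemma card_grid_slice:
  assumes "i < k" shows "card {P \<in> grid n k. P i = 0} \<le> n ^ (k - 1)"
proof (cases "n = 0")
  case True
  then have "grid n k = {}" using assms by (auto simp: grid_def PiE_eq_empty_iff)
  then show ?thesis by simp
next
  case False
  have "{P \<in> grid n k. P i = 0} \<subseteq> Pi\<^sub>E {..<k} (\<lambda>j. if j = i then {0} else {..<n})"
    by (auto simp: grid_def PiE_def Pi_def)
  then have "card {P \<in> grid n k. P i = 0} \<le> card (Pi\<^sub>E {..<k} (\<lambda>j. if j = i then {0} else {..<n}))"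
    by (intro card_mono finite_PiE) auto
  also have "\<dots> = n ^ (k - 1)"
    using assms by (simp add: card_PiE prod.remove[of _ i])
  finally show ?thesis .
qed

text \<open>Two nonattacking rooks that share a direction \<open>i\<close> lie on different lines parallel to the \<open>i\<close>-th
  axis, and there are \<open>n ^ (k - 1)\<close> such lines.\<close>

lemma max_nonattacking_le:
  assumes "1 \<le> l" shows "max_nonattacking n k l \<le> k * n ^ (k - 1)"
proof -
  obtain R where R: "R \<in> nonattacking_placements n k l" "card R = max_nonattacking n k l"
    using max_nonattacking_attained .
  have sub: "R \<subseteq> rooks n k l" "inj_on fst R"
    and nonatt: "\<And>r s. r \<in> R \<Longrightarrow> s \<in> R \<Longrightarrow> r \<noteq> s \<Longrightarrow> fst s \<notin> covered n k r"
    using R by (auto simp: nonattacking_placements_def placements_def)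
  define A where "A i = {r \<in> R. i \<in> snd r}" for i
  have "R \<subseteq> (\<Union>i<k. A i)"
  proof
    fix r assume "r \<in> R"
    then have "snd r \<subseteq> {..<k}" "card (snd r) = l" using sub(1) mem_rooks_iff by blast+
    moreover from this have "snd r \<noteq> {}" using assms by auto
    ultimately show "r \<in> (\<Union>i<k. A i)" using \<open>r \<in> R\<close> by (auto simp: A_def)
  qed
  moreover have "finite R" using sub(1) finite_rooks by (rule finite_subset)
  ultimately have "card R \<le> card (\<Union>i<k. A i)" by (intro card_mono) (auto simp: A_def)
  also have "\<dots> \<le> (\<Sum>i<k. card (A i))" by (rule card_UN_le) simp
  also have "\<dots> \<le> (\<Sum>i<k. n ^ (k - 1))"
  proof (rule sum_mono)
    fix i assume "i \<in> {..<k}"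
    then have "i < k" by simp
    \<comment> \<open>Each rook is sent to the point where its line along axis \<open>i\<close>
      meets the slice with coordinate \<open>i\<close> equal to 0.\<close>
    let ?g = "\<lambda>r. (fst r)(i := 0)"
    have inj: "inj_on ?g (A i)"
    proof (rule inj_onI, rule ccontr)
      fix r s assume rs: "r \<in> A i" "s \<in> A i" "?g r = ?g s" "r \<noteq> s"
      then have mem: "r \<in> R" "s \<in> R" "i \<in> snd r" by (auto simp: A_def)
      have eq: "fst s j = fst r j" if "j \<noteq> i" for j using fun_cong[OF rs(3), of j] that by simp
      have "fst s \<noteq> fst r" using inj_onD[OF sub(2)] mem rs(4) by metis
      then have "fst s i \<noteq> fst r i" using eq by (metis ext)
      moreover have "fst s \<in> grid n k" using mem(2) sub(1) mem_rooks_iff by blast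
      ultimately have "fst s \<in> covered n k r" using mem(3) eq by (auto simp: mem_covered_iff)
      then show False using nonatt[OF mem(1,2) rs(4)] by simp
    qed
    have "?g ` A i \<subseteq> {P \<in> grid n k. P i = 0}"
    proof (rule image_subsetI)
      fix r assume "r \<in> A i"
      then have "fst r \<in> grid n k" using sub(1) mem_rooks_iff unfolding A_def by blast
      moreover from grid_less[OF this \<open>i < k\<close>] have "0 < n" by simp
      ultimately show "?g r \<in> {P \<in> grid n k. P i = 0}"
        using grid_update[OF _ \<open>i < k\<close>] by simp
    qed
    then have "card (?g ` A i) \<le> card {P \<in> grid n k. P i = 0}"
      by (rule card_mono[rotated]) (simp add: finite_grid)
    then show "card (A i) \<le> n ^ (k - 1)"
      using card_grid_slice[OF \<open>i < k\<close>, of n] card_image[OF inj] by linarith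
  qed
  finally show ?thesis using R(2) by simp
qed

text \<open>A covering of the small grid is kept. The new points form \<open>k\<close> overlapping
  slabs, one for each coordinate that may be at least \<open>N\<close>. Each slab is swept by lines
  along another axis, with one rook at the foot of each line; hence the assumption
  \<open>2 \<le> k\<close> and the exponent \<open>k - 2\<close>.\<close>

lemma min_covering_extend:
  assumes "1 \<le> l" "l \<le> k" "2 \<le> k" "0 < N" "N \<le> M"
  shows "min_covering M k l \<le> min_covering N k l + k * ((M - N) * M ^ (k - 2))"
proof -
  obtain R where R: "R \<in> covering_placements N k l" "card R = min_covering N k l"
    using min_covering_attained[OF assms(2)] .
  have R_rooks: "R \<subseteq> rooks N k l" "inj_on fst R"
    and cover: "(\<Union>r\<in>R. covered N k r) = grid N k"
    using R by (auto simp: covering_placements_def placements_def)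
  have dirs: "\<exists>D. i \<in> D \<and> D \<subseteq> {..<k} \<and> card D = l" if "i < k" for i
    using exists_subset_between[of "{i}" l "{..<k}"] that assms by auto
  obtain D0 D1 where D: "0 \<in> D0" "D0 \<subseteq> {..<k}" "card D0 = l" "1 \<in> D1" "D1 \<subseteq> {..<k}" "card D1 = l"
    using dirs[of 0] dirs[of 1] assms(3) by auto
  \<comment> \<open>A new point is covered along axis 1 if its coordinate 0 is new and along axis 0 otherwise,
    so that the direction set of an added rook depends only on its position.\<close>
  define S where "S = {P \<in> grid M k. (N \<le> P 0 \<and> P 1 = 0) \<or> (P 0 = 0 \<and> (\<exists>i<k. N \<le> P i))}"
  define dir where "dir P = (if N \<le> P 0 then D1 else D0)" for P :: "nat \<Rightarrow> nat"
  define R' where "R' = R \<union> (\<lambda>P. (P, dir P)) ` S"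
  have new: "\<exists>i<k. N \<le> P i" if "P \<in> S" for P
    using that assms(3) by (auto simp: S_def intro: exI[of _ 0])
  have "R' \<subseteq> rooks M k l"
  proof
    fix r assume "r \<in> R'"
    then consider "r \<in> R" | P where "P \<in> S" "r = (P, dir P)" by (auto simp: R'_def)
    then show "r \<in> rooks M k l"
    proof cases
      case 1
      then have "r \<in> rooks N k l" using R_rooks(1) by blast
      then show ?thesis using grid_mono[OF assms(5)] by (auto simp: mem_rooks_iff)
    next
      case 2
      then show ?thesis using D by (simp add: mem_rooks_iff S_def dir_def)
    qed
  qed
  moreover have "inj_on fst R'"
  proof -
    \<comment> \<open>Added rooks stand outside the small grid, so no position is used
      twice.\<close>
    have "fst r \<noteq> P" if "r \<in> R" "P \<in> S" for r P
    proof -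
      have "fst r \<in> grid N k" using that R_rooks(1) mem_rooks_iff by blast
      then show ?thesis using new[OF that(2)] grid_less not_le by metis
    qed
    then have "fst ` R \<inter> S = {}" by blast
    then show ?thesis
      using R_rooks(2) unfolding R'_def inj_on_Un by (intro conjI) (auto simp: inj_on_def)
  qed
  moreover have "\<exists>r\<in>R'. Q \<in> covered M k r" if Q: "Q \<in> grid M k" for Q
  proof (cases "\<exists>i<k. N \<le> Q i")
    case False
    then have "Q \<in> grid N k" using Q by (auto simp: grid_def PiE_def Pi_def not_le)
    then obtain r where "r \<in> R" "Q \<in> covered N k r" using cover by blast
    then show ?thesis using Q by (auto simp: R'_def mem_covered_iff intro!: bexI[of _ r])
  next
    case True
    define c where "c = (if N \<le> Q 0 then 1 else 0 :: nat)"
    have c: "c < k" using assms(3) by (simp add: c_def)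
    define P where "P = Q(c := 0)"
    have "P \<in> grid M k" using grid_update[OF Q c, of 0] assms(4,5) by (simp add: P_def)
    \<comment> \<open>Resetting coordinate \<open>c\<close> keeps some coordinate new: either
      coordinate 0 is new and untouched, or it is old and the new coordinate is another one.\<close>
    moreover have "\<exists>i<k. N \<le> P i"
    proof -
      obtain i where "i < k" "N \<le> Q i" using True by blast
      then show ?thesis
        using c by (intro exI[of _ "if N \<le> Q 0 then 0 else i"]) (auto simp: P_def c_def intro: gr0I)
    qed
    moreover have "N \<le> P 0 \<and> P 1 = 0 \<or> P 0 = 0" by (simp add: P_def c_def)
    ultimately have "P \<in> S" unfolding S_def by blast
    \<comment> \<open>For \<open>c = 0\<close>, the assumption \<open>0 < N\<close> ensures that the
      reset coordinate counts as old, so \<open>dir P\<close> is \<open>D0\<close>.\<close>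
    moreover have "c \<in> dir P" using D assms(4) by (auto simp: dir_def P_def c_def)
    then have "Q \<in> covered M k (P, dir P)"
      using Q by (cases "Q c = P c") (auto simp: covered_def P_def)
    ultimately show ?thesis by (auto simp: R'_def)
  qed
  moreover have "covered M k r \<subseteq> grid M k" for r by (auto simp: covered_def)
  ultimately have "R' \<in> covering_placements M k l"
    by (fastforce simp: covering_placements_def placements_def)
  then have "min_covering M k l \<le> card R'" by (rule min_covering_le)
  also have "\<dots> \<le> card R + card S"
  proof -
    have "finite S" by (auto simp: S_def finite_grid)
    then show ?thesis
      unfolding R'_def by (meson add_left_mono card_Un_le card_image_le order_trans)
  qed
  also have "card S \<le> k * ((M - N) * M ^ (k - 2))"
  proof -
    \<comment> \<open>\<open>B i\<close> collects the feet of the lines that sweep the slab where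
      coordinate \<open>i\<close> is new: one coordinate is new, one is 0, and \<open>k - 2\<close>
      are free.\<close>
    define B where
      "B i = Pi\<^sub>E {..<k} (\<lambda>j. if j = i then {N..<M} else if j = (if i = 0 then 1 else 0) then {0} else {..<M})"
      for i
    have "S \<subseteq> (\<Union>i<k. B i)"
    proof
      fix P assume P: "P \<in> S"
      then have *: "P \<in> extensional {..<k}" "\<And>j. j < k \<Longrightarrow> P j < M"
        by (auto simp: S_def grid_def PiE_def)
      show "P \<in> (\<Union>i<k. B i)"
      proof (cases "N \<le> P 0")
        case True
        then have "P \<in> B 0" using P * assms(4) by (auto simp: S_def B_def PiE_def)
        then show ?thesis using assms(3) by (intro UN_I[of 0]) auto
      next
        case False
        then obtain i where i: "i < k" "N \<le> P i" "P 0 = 0" using P by (auto simp: S_def)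
        then have "P \<in> B i" using * assms(4) by (auto simp: B_def PiE_def)
        then show ?thesis using i(1) by auto
      qed
    qed
    then have "card S \<le> card (\<Union>i<k. B i)"
      by (intro card_mono) (auto simp: B_def intro!: finite_PiE)
    also have "\<dots> \<le> (\<Sum>i<k. card (B i))" by (rule card_UN_le) simp
    also have "\<dots> = (\<Sum>i<k. (M - N) * M ^ (k - 2))"
    proof (rule sum.cong[OF refl])
      fix i assume "i \<in> {..<k}"
      moreover define c where "c = (if i = 0 then 1 else 0 :: nat)"
      ultimately have ic: "i < k" "c < k" "c \<noteq> i" using assms(3) by auto
      define f where "f j = (if j = i then M - N else if j = c then 1 else M)" for j
      have "card (B i) = prod f {..<k}"
        unfolding B_def c_def[symmetric] by (subst card_PiE) (auto simp: f_def intro!: prod.cong)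
      also have "\<dots> = f i * (f c * prod f ({..<k} - {i} - {c}))"
        using ic by (subst prod.remove[of _ i], simp, simp) (subst prod.remove[of _ c], auto)
      also have "prod f ({..<k} - {i} - {c}) = (\<Prod>j\<in>{..<k} - {i} - {c}. M)"
        by (intro prod.cong) (auto simp: f_def)
      also have "\<dots> = M ^ (k - 2)" using ic by (simp add: numeral_2_eq_2)
      finally show "card (B i) = (M - N) * M ^ (k - 2)" using ic by (simp add: f_def)
    qed
    finally show ?thesis by simp
  qed
  finally show ?thesis using R(2) by simp
qed

text \<open>In dimension 1 there is no second axis for the sweeping argument, but a single rook
  already covers the whole line.\<close>

lemma min_covering_dim_1:
  assumes "0 < n" shows "min_covering n 1 1 = 1"
proof -
  let ?R = "{(\<lambda>i\<in>{..<1}. 0, {0})} :: rook set"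
  have "?R \<in> covering_placements n 1 1"
    using assms
    by (auto simp: covering_placements_def placements_def rooks_def covered_def grid_def PiE_def
        lessThan_Suc intro!: extensionalityI[of _ "{0}"])
  then have "min_covering n 1 1 \<le> 1" using min_covering_le by fastforce
  moreover obtain R where R: "R \<in> covering_placements n 1 1" "card R = min_covering n 1 1"
    using min_covering_attained[of 1 1] by auto
  have "card (grid n 1) \<noteq> 0" using assms by (simp add: card_grid)
  then have "R \<noteq> {}" using R(1) by (auto simp: covering_placements_def)
  then have "card R \<noteq> 0" using R(1) finite_placement by (auto simp: covering_placements_def)
  ultimately show ?thesis using R(2) by simp
qed

section \<open>Existence of the limits\<close>

text \<open>An abstract form of Fekete's lemma: letting \<open>M\<close> grow bounds the limit
  superior by every \<open>u n\<close> with \<open>0 < n\<close>, hence by their infimum, which is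
  also a lower bound for these terms.\<close>

lemma convergent_if_asymptotically_le_each_term:
  fixes u :: "nat \<Rightarrow> real" and e :: "nat \<Rightarrow> nat \<Rightarrow> real"
  assumes bound: "\<And>n. c \<le> u n"
    and le: "\<And>n M. 0 < n \<Longrightarrow> n \<le> M \<Longrightarrow> u M \<le> e n M"
    and lim: "\<And>n. 0 < n \<Longrightarrow> e n \<longlonglongrightarrow> u n"
  shows "convergent u"
proof -
  \<comment> \<open>Index 0 is left out: in the application to coverings with
    \<open>2 \<le> k\<close>, the quotient there is a division by zero with value 0, which would
    spoil the infimum.\<close>
  define L where "L = (INF n\<in>{0<..}. u n)"
  have bdd: "bdd_below (u ` {0<..})" using bound by (auto intro!: bdd_belowI[of _ c])
  have "u \<longlonglongrightarrow> L"
  proof (rule order_tendstoI)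
    fix a assume "a < L"
    moreover have "L \<le> u n" if "0 < n" for n
      unfolding L_def using bdd that by (intro cINF_lower) auto
    ultimately have "a < u n" if "0 < n" for n using that less_le_trans by blast
    then show "\<forall>\<^sub>F n in sequentially. a < u n"
      using eventually_gt_at_top[of 0] by (rule eventually_mono[rotated])
  next
    fix a assume "L < a"
    then obtain n where n: "0 < n" "u n < a"
      unfolding L_def using cINF_less_iff[OF _ bdd] by auto
    have "\<forall>\<^sub>F M in sequentially. e n M < a" using lim[OF n(1)] n(2) by (rule order_tendstoD)
    with eventually_ge_at_top[of n] show "\<forall>\<^sub>F M in sequentially. u M < a"
      by eventually_elim (use le[OF n(1)] in \<open>auto intro: le_less_trans\<close>)
  qed
  then show ?thesis by (rule convergentI)
qed

text \<open>A covering for side \<open>n\<close> is blown up to the largest multiple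
  \<open>m * n\<close> of \<open>n\<close> up to \<open>M\<close> and then extended to
  \<open>M\<close>. At most \<open>n\<close> layers are added, costing at most
  \<open>k * n / M\<close> after normalisation, which tends to 0.\<close>

lemma convergent_min_covering:
  assumes "1 \<le> l" "l \<le> k"
  shows "convergent (\<lambda>n. real (min_covering n k l) / real n ^ (k - 1))"
proof (cases "k = 1")
  case True
  then have "l = 1" using assms by simp
  have "\<forall>\<^sub>F n in sequentially. real (min_covering n k l) / real n ^ (k - 1) = 1"
    using eventually_gt_at_top[of 0] by eventually_elim (simp add: True \<open>l = 1\<close> min_covering_dim_1[simplified])
  then show ?thesis by (intro convergentI[of _ 1] tendsto_eventually)
next
  case False
  then have "2 \<le> k" using assms by simp
  show ?thesis
  proof (rule convergent_if_asymptotically_le_each_term[where c = 0 and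
        e = "\<lambda>n M. real (min_covering n k l) / real n ^ (k - 1) + real k * real n / real M"])
    fix n M :: nat assume n: "0 < n" "n \<le> M"
    define m where "m = M div n"
    have m: "0 < m" using n by (simp add: m_def div_greater_zero_iff)
    have mn: "m * n \<le> M" "M - m * n \<le> n"
      using n by (simp_all add: m_def minus_div_mult_eq_mod less_imp_le)
    have "min_covering M k l \<le> min_covering (m * n) k l + k * ((M - m * n) * M ^ (k - 2))"
      using m n mn assms \<open>2 \<le> k\<close> by (intro min_covering_extend) auto
    also have "\<dots> \<le> m ^ (k - 1) * min_covering n k l + k * (n * M ^ (k - 2))"
      using min_covering_mult_le[OF assms m] mn by (intro add_mono mult_le_mono) auto
    finally have "real (min_covering M k l)
        \<le> real m ^ (k - 1) * real (min_covering n k l) + real k * (real n * real M ^ (k - 2))"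
      by (metis (mono_tags) of_nat_add of_nat_le_iff of_nat_mult of_nat_power)
    then have "real (min_covering M k l) / real M ^ (k - 1)
        \<le> (real m ^ (k - 1) * real (min_covering n k l)) / real M ^ (k - 1)
          + real k * (real n * real M ^ (k - 2)) / real M ^ (k - 1)"
      by (metis add_divide_distrib divide_right_mono of_nat_0_le_iff zero_le_power)
    \<comment> \<open>Since \<open>m * n \<le> M\<close>, the ratio \<open>m / M\<close> is at most
      \<open>1 / n\<close>.\<close>
    also have "(real m ^ (k - 1) * real (min_covering n k l)) / real M ^ (k - 1)
        \<le> real (min_covering n k l) / real n ^ (k - 1)"
    proof -
      have "(real m * real n) ^ (k - 1) \<le> real M ^ (k - 1)"
        using mn(1) by (intro power_mono) (auto simp flip: of_nat_mult)
      then have "real (min_covering n k l) * (real m * real n) ^ (k - 1)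
          \<le> real (min_covering n k l) * real M ^ (k - 1)"
        by (rule mult_left_mono) simp
      then show ?thesis using n by (simp add: field_simps power_mult_distrib)
    qed
    also have "real k * (real n * real M ^ (k - 2)) / real M ^ (k - 1) = real k * real n / real M"
    proof -
      have "k - 1 = Suc (k - 2)" using \<open>2 \<le> k\<close> by simp
      then show ?thesis using n by simp
    qed
    finally show "real (min_covering M k l) / real M ^ (k - 1)
        \<le> real (min_covering n k l) / real n ^ (k - 1) + real k * real n / real M"
      by simp
  next
    fix n :: nat
    have "(\<lambda>M. real k * real n / real M) \<longlonglongrightarrow> 0" by (rule lim_const_over_n)
    then show "(\<lambda>M. real (min_covering n k l) / real n ^ (k - 1) + real k * real n / real M)
        \<longlonglongrightarrow> real (min_covering n k l) / real n ^ (k - 1)"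
      using tendsto_add[OF tendsto_const] by fastforce
  qed simp
qed

text \<open>Negation turns the supremum into an infimum. Rounding \<open>M\<close> down to
  \<open>m * n\<close> loses at most the factor \<open>(1 - n / M) ^ (k - 1)\<close>, which tends to
  1.\<close>

lemma convergent_max_nonattacking:
  assumes "1 \<le> l" "l \<le> k"
  shows "convergent (\<lambda>n. real (max_nonattacking n k l) / real n ^ (k - 1))"
proof -
  have "convergent (\<lambda>n. - (real (max_nonattacking n k l) / real n ^ (k - 1)))"
  proof (rule convergent_if_asymptotically_le_each_term[where c = "- real k" and
        e = "\<lambda>n M. - (real (max_nonattacking n k l) / real n ^ (k - 1)
          * (1 - real n / real M) ^ (k - 1))"])
    fix n
    have "real (max_nonattacking n k l) \<le> real k * real n ^ (k - 1)"
      using max_nonattacking_le[OF assms(1), of n k]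
      by (metis (mono_tags) of_nat_le_iff of_nat_mult of_nat_power)
    \<comment> \<open>The denominator vanishes only for \<open>n = 0\<close> and
      \<open>2 \<le> k\<close>; the quotient is then 0 by convention and the bound still
      holds.\<close>
    then show "- real k \<le> - (real (max_nonattacking n k l) / real n ^ (k - 1))"
      by (cases "real n ^ (k - 1) = 0") (auto simp: divide_le_eq)
  next
    fix n M :: nat assume n: "0 < n" "n \<le> M"
    define m where "m = M div n"
    have m: "0 < m" using n by (simp add: m_def div_greater_zero_iff)
    have mn: "m * n \<le> M" "M - m * n \<le> n"
      using n by (simp_all add: m_def minus_div_mult_eq_mod less_imp_le)
    have "m ^ (k - 1) * max_nonattacking n k l \<le> max_nonattacking (m * n) k l"
      using assms m by (intro max_nonattacking_mult_ge) auto
    also have "\<dots> \<le> max_nonattacking M k l" using mn(1) by (rule max_nonattacking_mono)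
    finally have *: "real m ^ (k - 1) * real (max_nonattacking n k l) \<le> real (max_nonattacking M k l)"
      by (metis (mono_tags) of_nat_le_iff of_nat_mult of_nat_power)
    have "real M - real n \<le> real m * real n"
      using mn by (simp flip: of_nat_mult add: le_diff_conv)
    then have "(real M - real n) / real M \<le> real m * real n / real M" by (rule divide_right_mono) simp
    then have "1 - real n / real M \<le> real m * real n / real M" using n by (simp add: diff_divide_distrib)
    \<comment> \<open>Monotonicity of the power needs \<open>1 - n / M\<close> to be nonnegative,
      which follows from \<open>n \<le> M\<close>.\<close>
    then have "(1 - real n / real M) ^ (k - 1) \<le> (real m * real n / real M) ^ (k - 1)"
      using n by (intro power_mono) auto
    then have "real (max_nonattacking n k l) / real n ^ (k - 1) * (1 - real n / real M) ^ (k - 1)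
        \<le> real (max_nonattacking n k l) / real n ^ (k - 1) * (real m * real n / real M) ^ (k - 1)"
      by (intro mult_left_mono) auto
    also have "\<dots> = real m ^ (k - 1) * real (max_nonattacking n k l) / real M ^ (k - 1)"
      using n by (simp add: power_mult_distrib power_divide)
    also have "\<dots> \<le> real (max_nonattacking M k l) / real M ^ (k - 1)"
      using * by (intro divide_right_mono) auto
    finally show "- (real (max_nonattacking M k l) / real M ^ (k - 1))
        \<le> - (real (max_nonattacking n k l) / real n ^ (k - 1) * (1 - real n / real M) ^ (k - 1))"
      by simp
  next
    fix n :: nat
    have "(\<lambda>M. - (real (max_nonattacking n k l) / real n ^ (k - 1) * (1 - real n / real M) ^ (k - 1)))
        \<longlonglongrightarrow> - (real (max_nonattacking n k l) / real n ^ (k - 1) * (1 - 0) ^ (k - 1))"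
      by (intro tendsto_intros lim_const_over_n)
    then show "(\<lambda>M. - (real (max_nonattacking n k l) / real n ^ (k - 1) * (1 - real n / real M) ^ (k - 1)))
        \<longlonglongrightarrow> - (real (max_nonattacking n k l) / real n ^ (k - 1))"
      by simp
  qed
  then show ?thesis by (simp add: convergent_minus_iff[symmetric])
qed

theorem theorem5:
  fixes k l :: nat
  assumes "1 \<le> l" and "l \<le> k"
  shows "convergent (\<lambda>n. real (min_covering n k l) / real n ^ (k - 1)) \<and>
         convergent (\<lambda>n. real (max_nonattacking n k l) / real n ^ (k - 1))"
  using convergent_min_covering[OF assms] convergent_max_nonattacking[OF assms] by blast

end
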